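(* Let $C_4$ be the cycle on vertices $1,2,3,4$ with edges $12,23,34,41$ (indices mod 4). Let $\theta$ be a weight function that is positively homogeneous of degree one and concave, let $E$ be a smooth function on $(0,\infty)^4$, and suppose that for each edge $ij$ of $C_4$, $\theta(p_i,p_j)=\frac{p_i-p_j}{\frac{\partial E}{\partial p_i}-\frac{\partial E}{\partial p_j}}$. Set $\theta_{ij}=\theta(p_i,p_j)$ for edges, $\theta_{ij}=0$ otherwise, $\eta_{ij}=\theta_{ij}(\partial_{p_i}E-\partial_{p_j}E)$, $$\Gamma^{C_4}_2(f,f)=\frac12\sum_{i,j,k=1}^4 (f_i-f_j)^2\left(\frac{\partial\theta_{ij}}{\partial p_i}\eta_{ki}+\frac{\partial\eta_{ij}}{\partial p_i}\theta_{ki}+\frac{\partial\eta_{jk}}{\partial p_j}\theta_{ij}-\frac{\partial\eta_{ki}}{\partial p_k}\theta_{jk}\right),$$ and for each edge $ij$ $$\Gamma^{ij}_2(f,f)=(f_i-f_j)^2\left[-\frac12\left(\frac{\partial\theta_{ij}}{\partial p_i}-\frac{\partial\theta_{ij}}{\partial p_j}\right)\eta_{ij}+\left(\frac{\partial\eta_{ij}}{\partial p_i}-\frac{\partial\eta_{ij}}{\partial p_j}\right)\theta_{ij}\right].$$ Then $\theta$ has the $C_4$-property with respect to $E$: for every $p$ in the interior of the probability simplex in $\mathbb{R}^4$ and every $f\in\mathbb{R}^4$, $$\Gamma^{C_4}_2(f,f)\ge\sum_{ij\in E(C_4)}\Gamma^{ij}_2(f,f).$$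
   Context: A weight function is $\theta:[0,\infty)^2\to[0,\infty)$, continuous, $C^\infty$ on $(0,\infty)^2$, symmetric and positive on $(0,\infty)^2$. Positive homogeneity of degree one means $\theta(\lambda s,\lambda t)=\lambda\theta(s,t)$ for $\lambda>0$. ($\Gamma^{C_4}_2$ equals the second time derivative of $E$ along constant-speed geodesics of the mean-field transport metric on $C_4$, so the property is stated for all $(p,f)$.) *)

theory Defs
  imports "HOL-Analysis.Analysis"
begin

text \<open>
  \<open>C\<^sup>k\<close> maps on an open set: all directional derivatives (along fixed directions) of order
  at most \<open>k\<close> exist as values of Frechet derivatives and are continuous.
\<close>

primrec higher_differentiable_on ::
  "'a::real_normed_vector set \<Rightarrow> ('a \<Rightarrow> 'b::real_normed_vector) \<Rightarrow> nat \<Rightarrow> bool" where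
  "higher_differentiable_on S f 0 \<longleftrightarrow> continuous_on S f"
| "higher_differentiable_on S f (Suc n) \<longleftrightarrow>
     (\<forall>x\<in>S. f differentiable (at x)) \<and>
     (\<forall>v. higher_differentiable_on S (\<lambda>x. frechet_derivative f (at x) v) n)"

definition smooth_on :: "'a::real_normed_vector set \<Rightarrow> ('a \<Rightarrow> 'b::real_normed_vector) \<Rightarrow> bool" where
  "smooth_on S f \<longleftrightarrow> (\<forall>n. higher_differentiable_on S f n)"

definition partial :: "'n::finite \<Rightarrow> (real^'n \<Rightarrow> real) \<Rightarrow> real^'n \<Rightarrow> real" where
  "partial i F p = deriv (\<lambda>t. F (p + t *\<^sub>R axis i 1)) 0"

text \<open>
  Functions on \<open>[0,\<infinity>)\<^sup>2\<close> are total functions of which only the values on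
  \<open>{0..} \<times> {0..}\<close> are constrained.
\<close>

definition weight_function :: "(real \<times> real \<Rightarrow> real) \<Rightarrow> bool" where
  "weight_function \<theta> \<longleftrightarrow>
     (\<forall>s\<ge>0. \<forall>t\<ge>0. \<theta> (s, t) \<ge> 0) \<and>
     continuous_on ({0..} \<times> {0..}) \<theta> \<and>
     smooth_on ({0<..} \<times> {0<..}) \<theta> \<and>
     (\<forall>s>0. \<forall>t>0. \<theta> (s, t) = \<theta> (t, s)) \<and>
     (\<forall>s>0. \<forall>t>0. \<theta> (s, t) > 0)"

definition pos_homogeneous :: "(real \<times> real \<Rightarrow> real) \<Rightarrow> bool" where
  "pos_homogeneous \<theta> \<longleftrightarrow>
     (\<forall>c>0. \<forall>s\<ge>0. \<forall>t\<ge>0. \<theta> (c * s, c * t) = c * \<theta> (s, t))"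

definition pos_orthant :: "(real^'n::finite) set" where
  "pos_orthant = {p. \<forall>i. 0 < p $ i}"

definition interior_prob_simplex :: "(real^'n::finite) set" where
  "interior_prob_simplex = {p. (\<forall>i. 0 < p $ i) \<and> (\<Sum>i\<in>UNIV. p $ i) = 1}"

text \<open>
  The vertices are the elements \<open>1, 2, 3, 4\<close> of the type \<open>4\<close> of integers mod 4 (so \<open>4 = 0\<close>).
  Each undirected edge is listed once, in one of its two orientations.
\<close>

definition C4_edges :: "(4 \<times> 4) set" where
  "C4_edges = {(1, 2), (2, 3), (3, 4), (4, 1)}"

definition C4_adj :: "4 \<Rightarrow> 4 \<Rightarrow> bool" where
  "C4_adj i j \<longleftrightarrow> (i, j) \<in> C4_edges \<or> (j, i) \<in> C4_edges"

definition edge_theta :: "(real \<times> real \<Rightarrow> real) \<Rightarrow> 4 \<Rightarrow> 4 \<Rightarrow> real^4 \<Rightarrow> real" where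
  "edge_theta \<theta> i j p = (if C4_adj i j then \<theta> (p $ i, p $ j) else 0)"

definition edge_eta ::
  "(real \<times> real \<Rightarrow> real) \<Rightarrow> (real^4 \<Rightarrow> real) \<Rightarrow> 4 \<Rightarrow> 4 \<Rightarrow> real^4 \<Rightarrow> real" where
  "edge_eta \<theta> E i j p = edge_theta \<theta> i j p * (partial i E p - partial j E p)"

definition Gamma2_C4 ::
  "(real \<times> real \<Rightarrow> real) \<Rightarrow> (real^4 \<Rightarrow> real) \<Rightarrow> real^4 \<Rightarrow> real^4 \<Rightarrow> real" where
  "Gamma2_C4 \<theta> E p f =
     1/2 * (\<Sum>i\<in>UNIV. \<Sum>j\<in>UNIV. \<Sum>k\<in>UNIV. (f $ i - f $ j)\<^sup>2 *
       (partial i (edge_theta \<theta> i j) p * edge_eta \<theta> E k i p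
        + partial i (edge_eta \<theta> E i j) p * edge_theta \<theta> k i p
        + partial j (edge_eta \<theta> E j k) p * edge_theta \<theta> i j p
        - partial k (edge_eta \<theta> E k i) p * edge_theta \<theta> j k p))"

definition Gamma2_edge ::
  "(real \<times> real \<Rightarrow> real) \<Rightarrow> (real^4 \<Rightarrow> real) \<Rightarrow> 4 \<Rightarrow> 4 \<Rightarrow> real^4 \<Rightarrow> real^4 \<Rightarrow> real" where
  "Gamma2_edge \<theta> E i j p f =
     (f $ i - f $ j)\<^sup>2 *
       (- (1/2) * (partial i (edge_theta \<theta> i j) p - partial j (edge_theta \<theta> i j) p)
          * edge_eta \<theta> E i j p
        + (partial i (edge_eta \<theta> E i j) p - partial j (edge_eta \<theta> E i j) p)
          * edge_theta \<theta> i j p)"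

definition C4_property :: "(real \<times> real \<Rightarrow> real) \<Rightarrow> (real^4 \<Rightarrow> real) \<Rightarrow> bool" where
  "C4_property \<theta> E \<longleftrightarrow>
     (\<forall>p\<in>interior_prob_simplex. \<forall>f.
        Gamma2_C4 \<theta> E p f \<ge> (\<Sum>(i, j)\<in>C4_edges. Gamma2_edge \<theta> E i j p f))"

end

theory Submission
  imports Defs
begin

text \<open>
  The hypothesis on \<open>E\<close> says \<open>\<eta>\<^sub>i\<^sub>j = p\<^sub>i - p\<^sub>j\<close> on edges, on the diagonal by continuity, so both
  sides are explicit in \<open>\<theta>\<close> and its first derivatives. Concavity and homogeneity make \<open>\<theta>\<close>
  superadditive, hence \<open>D\<theta>(x) y \<ge> \<theta>(y)\<close>, with equality for \<open>y = x\<close> (Euler). With these, the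
  coefficient of each edge term in the difference of the two sides is at least \<open>S / 2\<close>, where \<open>S\<close>
  is the sum of \<open>\<theta>\<close> over the edges, while the two diagonals contribute \<open>- S / 2\<close> each. What
  remains is \<open>S / 2 * (f\<^sub>1 - f\<^sub>2 + f\<^sub>3 - f\<^sub>4)\<^sup>2\<close>.
\<close>

section \<open>Partial derivatives on the positive orthant\<close>

lemma open_pos_orthant: "open (pos_orthant :: (real^'n::finite) set)"
proof -
  have "pos_orthant = (\<Inter>i. {p :: real^'n. 0 < p $ i})"
    by (auto simp: pos_orthant_def)
  moreover have "open (\<Inter>i. {p :: real^'n. 0 < p $ i})"
    by (intro open_INT ballI open_Collect_less continuous_intros) auto
  ultimately show ?thesis by simp
qed

lemma eventually_pos_orthant:
  fixes p v :: "real^'n::finite"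
  assumes "p \<in> pos_orthant"
  shows "\<forall>\<^sub>F t in nhds (0::real). p + t *\<^sub>R v \<in> pos_orthant"
proof -
  have "((\<lambda>t::real. p + t *\<^sub>R v) \<longlongrightarrow> p + 0 *\<^sub>R v) (nhds 0)"
    by (intro tendsto_intros filterlim_ident)
  then show ?thesis
    using topological_tendstoD[OF _ open_pos_orthant] assms by simp
qed

text \<open>Only values near \<open>p\<close> along one axis matter, so identities that hold just on
  the open orthant may be differentiated.\<close>

lemma partial_cong_on_pos_orthant:
  assumes "\<And>q. q \<in> pos_orthant \<Longrightarrow> F q = G q" and "p \<in> pos_orthant"
  shows "partial i F p = partial i G p"
  unfolding partial_def
  by (rule deriv_cong_ev[OF eventually_mono[OF eventually_pos_orthant[OF assms(2), of "axis i 1"]]])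
    (simp_all add: assms(1))

lemma smooth_on_differentiable: "smooth_on S f \<Longrightarrow> x \<in> S \<Longrightarrow> f differentiable (at x)"
  unfolding smooth_on_def by (metis higher_differentiable_on.simps(2))

lemma smooth_on_continuous_frechet_derivative:
  "smooth_on S f \<Longrightarrow> continuous_on S (\<lambda>x. frechet_derivative f (at x) v)"
  unfolding smooth_on_def by (metis higher_differentiable_on.simps)

lemma has_real_derivative_along:
  fixes f :: "'a::real_normed_vector \<Rightarrow> real"
  assumes "(f has_derivative D) (at x)"
  shows "((\<lambda>t. f (x + t *\<^sub>R v)) has_real_derivative D v) (at 0)"
proof -
  have "((\<lambda>t::real. x + t *\<^sub>R v) has_derivative (\<lambda>t. t *\<^sub>R v)) (at 0)"
    by (auto intro!: derivative_eq_intros)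
  from has_derivative_compose[OF this, of f D] assms
  have "((\<lambda>t. f (x + t *\<^sub>R v)) has_derivative (\<lambda>t. D (t *\<^sub>R v))) (at 0)"
    by simp
  then show ?thesis
    using linear_cmul[OF has_derivative_linear[OF assms]]
    by (simp add: has_field_derivative_def mult.commute mult_commute_abs)
qed

lemma partial_eq_derivative:
  "(F has_derivative D) (at p) \<Longrightarrow> partial i F p = D (axis i 1)"
  unfolding partial_def by (rule DERIV_imp_deriv) (rule has_real_derivative_along)

text \<open>Serves to pass to the limit in the partial derivatives of \<open>E\<close> at points
  with \<open>p $ i = p $ j\<close>.\<close>

lemma smooth_on_isCont_partial:
  assumes "smooth_on pos_orthant F" and "p \<in> pos_orthant"
  shows "isCont (partial i F) p"
proof -
  have "continuous_on pos_orthant (partial i F)"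
    using smooth_on_continuous_frechet_derivative[OF assms(1), of "axis i 1"]
    by (rule continuous_on_eq)
      (use smooth_on_differentiable[OF assms(1)] in
        \<open>auto simp: frechet_derivative_works intro: partial_eq_derivative[symmetric]\<close>)
  then show ?thesis
    using assms(2) open_pos_orthant continuous_on_eq_continuous_at by blast
qed

lemma not_C4_adj_refl: "\<not> C4_adj i i"
  by (auto simp: C4_adj_def C4_edges_def)

lemma C4_adj_sym: "C4_adj i j \<longleftrightarrow> C4_adj j i"
  by (auto simp: C4_adj_def)

section \<open>Derivatives of the weight function\<close>

context
  fixes \<theta> :: "real \<times> real \<Rightarrow> real"
  assumes weight: "weight_function \<theta>"
begin

lemma weight_sym: "s > 0 \<Longrightarrow> t > 0 \<Longrightarrow> \<theta> (s, t) = \<theta> (t, s)"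
  using weight by (auto simp: weight_function_def)

lemma weight_pos: "s > 0 \<Longrightarrow> t > 0 \<Longrightarrow> \<theta> (s, t) > 0"
  using weight by (auto simp: weight_function_def)

lemma weight_has_derivative:
  assumes "s > 0" "t > 0"
  shows "(\<theta> has_derivative frechet_derivative \<theta> (at (s, t))) (at (s, t))"
  using smooth_on_differentiable[of "{0<..} \<times> {0<..}" \<theta> "(s, t)"] weight assms
  by (simp add: weight_function_def frechet_derivative_works)

lemma partial_edge_theta:
  assumes "p \<in> pos_orthant" and "C4_adj i j"
  shows "partial i (edge_theta \<theta> i j) p = frechet_derivative \<theta> (at (p $ i, p $ j)) (1, 0)"
    and "partial j (edge_theta \<theta> i j) p = frechet_derivative \<theta> (at (p $ i, p $ j)) (0, 1)"
proof -
  let ?D = "frechet_derivative \<theta> (at (p $ i, p $ j))"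
  have "i \<noteq> j" using assms(2) not_C4_adj_refl by blast
  have "(\<theta> has_derivative ?D) (at (p $ i, p $ j))"
    using assms(1) by (intro weight_has_derivative) (auto simp: pos_orthant_def)
  moreover have "((\<lambda>q. (q $ i, q $ j)) has_derivative (\<lambda>v. (v $ i, v $ j))) (at p)"
    by (intro has_derivative_Pair bounded_linear_imp_has_derivative bounded_linear_vec_nth)
  ultimately have "((\<lambda>q. \<theta> (q $ i, q $ j)) has_derivative (\<lambda>v. ?D (v $ i, v $ j))) (at p)"
    using has_derivative_compose by blast
  moreover have "edge_theta \<theta> i j = (\<lambda>q. \<theta> (q $ i, q $ j))"
    using assms(2) by (auto simp: edge_theta_def)
  ultimately have "(edge_theta \<theta> i j has_derivative (\<lambda>v. ?D (v $ i, v $ j))) (at p)"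
    by simp
  note * = partial_eq_derivative[OF this]
  show "partial i (edge_theta \<theta> i j) p = ?D (1, 0)" "partial j (edge_theta \<theta> i j) p = ?D (0, 1)"
    using \<open>i \<noteq> j\<close> by (simp_all add: * axis_def)
qed

text \<open>Symmetry of \<open>\<theta>\<close> is assumed for positive arguments only, so the two
  functions are compared just on \<open>pos_orthant\<close>.\<close>

lemma partial_edge_theta_sym:
  assumes "p \<in> pos_orthant"
  shows "partial k (edge_theta \<theta> i j) p = partial k (edge_theta \<theta> j i) p"
  by (rule partial_cong_on_pos_orthant[OF _ assms])
    (auto simp: edge_theta_def pos_orthant_def C4_adj_sym[of i j] intro: weight_sym)

context
  assumes hom: "pos_homogeneous \<theta>"
begin

lemma weight_scale: "c > 0 \<Longrightarrow> s \<ge> 0 \<Longrightarrow> t \<ge> 0 \<Longrightarrow> \<theta> (c * s, c * t) = c * \<theta> (s, t)"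
  using hom by (auto simp: pos_homogeneous_def)

text \<open>Both sides are the derivative at \<open>h = 0\<close> of \<open>\<theta>\<close> along
  the ray through \<open>(s, t)\<close>, computed once by the chain rule and once by
  homogeneity.\<close>

lemma weight_Euler:
  assumes "s > 0" "t > 0"
  shows "frechet_derivative \<theta> (at (s, t)) (s, t) = \<theta> (s, t)"
proof -
  have "((\<lambda>h. \<theta> ((s, t) + h *\<^sub>R (s, t))) has_real_derivative
      frechet_derivative \<theta> (at (s, t)) (s, t)) (at 0)"
    using assms by (intro has_real_derivative_along weight_has_derivative)
  moreover have "((\<lambda>h. \<theta> ((s, t) + h *\<^sub>R (s, t))) has_real_derivative \<theta> (s, t)) (at 0)"
  \<comment> \<open>On \<open>{-1<..}\<close> the factor \<open>1 + h\<close> is positive, as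
    homogeneity requires.\<close>
  proof (rule has_field_derivative_transform_within_open[of "\<lambda>h. (1 + h) * \<theta> (s, t)" _ _ "{-1<..}"])
    show "((\<lambda>h. (1 + h) * \<theta> (s, t)) has_real_derivative \<theta> (s, t)) (at 0)"
      by (auto intro!: derivative_eq_intros)
    fix h :: real assume "h \<in> {-1<..}"
    then show "(1 + h) * \<theta> (s, t) = \<theta> ((s, t) + h *\<^sub>R (s, t))"
      using weight_scale[of "1 + h" s t] assms by (simp add: algebra_simps)
  qed auto
  ultimately show ?thesis by (rule DERIV_unique)
qed

text \<open>Midpoint concavity at the doubled points; homogeneity cancels the factors 2 and
  1/2.\<close>

lemma weight_superadditive:
  assumes "concave_on ({0..} \<times> {0..}) \<theta>" "s \<ge> 0" "t \<ge> 0" "x \<ge> 0" "y \<ge> 0"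
  shows "\<theta> (s, t) + \<theta> (x, y) \<le> \<theta> (s + x, t + y)"
proof -
  have "\<theta> ((1/2) *\<^sub>R (2 * s, 2 * t) + (1/2) *\<^sub>R (2 * x, 2 * y))
      \<ge> (1/2) * \<theta> (2 * s, 2 * t) + (1/2) * \<theta> (2 * x, 2 * y)"
    using concave_onD[OF assms(1), of "1/2" "(2 * s, 2 * t)" "(2 * x, 2 * y)"] assms by simp
  then show ?thesis
    using weight_scale[of 2 s t] weight_scale[of 2 x y] assms by simp
qed

text \<open>Superadditivity and homogeneity bound the difference quotient from below for every
  \<open>h > 0\<close>; the right-hand limit keeps the bound.\<close>

lemma weight_le_derivative:
  assumes "concave_on ({0..} \<times> {0..}) \<theta>" "s > 0" "t > 0" "x \<ge> 0" "y \<ge> 0"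
  shows "\<theta> (x, y) \<le> frechet_derivative \<theta> (at (s, t)) (x, y)"
proof -
  let ?D = "frechet_derivative \<theta> (at (s, t))"
  have "((\<lambda>h. \<theta> ((s, t) + h *\<^sub>R (x, y))) has_real_derivative ?D (x, y)) (at 0)"
    using assms by (intro has_real_derivative_along weight_has_derivative)
  then have "((\<lambda>h. (\<theta> ((s, t) + h *\<^sub>R (x, y)) - \<theta> (s, t)) / h) \<longlongrightarrow> ?D (x, y)) (at 0)"
    by (simp add: DERIV_def)
  then have "((\<lambda>h. (\<theta> ((s, t) + h *\<^sub>R (x, y)) - \<theta> (s, t)) / h) \<longlongrightarrow> ?D (x, y)) (at_right 0)"
    by (rule tendsto_mono[rotated]) (simp add: at_le)
  moreover have "\<forall>\<^sub>F h in at_right 0. \<theta> (x, y) \<le> (\<theta> ((s, t) + h *\<^sub>R (x, y)) - \<theta> (s, t)) / h"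
  proof (rule eventually_at_right_less[THEN eventually_mono])
    fix h :: real assume "0 < h"
    then show "\<theta> (x, y) \<le> (\<theta> ((s, t) + h *\<^sub>R (x, y)) - \<theta> (s, t)) / h"
      using weight_superadditive[of s t "h * x" "h * y"] weight_scale[of h x y] assms
      by (simp add: field_simps)
  qed
  ultimately show ?thesis
    by (intro tendsto_lowerbound) auto
qed

end

section \<open>The functions \<open>edge_eta\<close> in closed form\<close>

context
  fixes E :: "real^4 \<Rightarrow> real"
  assumes E_smooth: "smooth_on pos_orthant E"
    and E_quotient: "\<And>i j p. C4_adj i j \<Longrightarrow> p \<in> pos_orthant \<Longrightarrow> p $ i \<noteq> p $ j \<Longrightarrow>
      \<theta> (p $ i, p $ j) = (p $ i - p $ j) / (partial i E p - partial j E p)"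
begin

lemma partial_diff_eq:
  assumes "C4_adj i j" "p \<in> pos_orthant" "p $ i \<noteq> p $ j"
  shows "partial i E p - partial j E p = (p $ i - p $ j) / \<theta> (p $ i, p $ j)"
proof -
  have "\<theta> (p $ i, p $ j) > 0"
    using assms(2) by (auto simp: pos_orthant_def intro: weight_pos)
  \<comment> \<open>A vanishing denominator would make the quotient 0 by the division convention,
    against positivity.\<close>
  with E_quotient[OF assms] show ?thesis
    by (cases "partial i E p - partial j E p = 0") (auto simp: field_simps)
qed

text \<open>The quotient hypothesis is silent on the diagonal. After a move by \<open>t\<close>
  along axis \<open>i\<close> it gives the difference
  \<open>t / \<theta> (p $ i + t, p $ j)\<close>, which tends to 0; continuity of the partial
  derivatives does the rest.\<close>

lemma partial_diff_eq_0:
  assumes "C4_adj i j" "p \<in> pos_orthant" "p $ i = p $ j"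
  shows "partial i E p - partial j E p = 0"
proof -
  define q where "q t = p + t *\<^sub>R axis i 1" for t :: real
  have "i \<noteq> j" using assms(1) not_C4_adj_refl by blast
  have q_nth: "q t $ i = p $ i + t" "q t $ j = p $ j" for t
    using \<open>i \<noteq> j\<close> by (auto simp: q_def axis_def)
  have pos: "p $ k > 0" for k
    using assms(2) by (auto simp: pos_orthant_def)
  have q_lim: "(q \<longlongrightarrow> p) (at 0)"
    unfolding q_def by (auto intro!: tendsto_eq_intros)
  have "((\<lambda>t. partial i E (q t) - partial j E (q t)) \<longlongrightarrow> partial i E p - partial j E p) (at 0)"
    using smooth_on_isCont_partial[OF E_smooth assms(2)] q_lim
    by (intro tendsto_diff) (auto intro: isCont_tendsto_compose)
  moreover have "((\<lambda>t. partial i E (q t) - partial j E (q t)) \<longlongrightarrow> 0) (at 0)"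
  proof (rule Lim_transform_eventually)
    have "isCont \<theta> (p $ i, p $ j)"
      using weight_has_derivative pos has_derivative_continuous by blast
    moreover have "((\<lambda>t. (p $ i + t, p $ j)) \<longlongrightarrow> (p $ i, p $ j)) (at (0::real))"
      by (auto intro!: tendsto_eq_intros)
    ultimately have "((\<lambda>t. \<theta> (p $ i + t, p $ j)) \<longlongrightarrow> \<theta> (p $ i, p $ j)) (at 0)"
      by (rule isCont_tendsto_compose)
    then show "((\<lambda>t. t / \<theta> (p $ i + t, p $ j)) \<longlongrightarrow> 0) (at 0)"
      using weight_pos[OF pos pos, of i j] by (auto intro!: tendsto_eq_intros)
    have "\<forall>\<^sub>F t in at 0. q t \<in> pos_orthant"
      using topological_tendstoD[OF q_lim open_pos_orthant assms(2)] .
    moreover have "\<forall>\<^sub>F t in at (0::real). t \<noteq> 0"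
      by (simp add: eventually_at_filter)
    ultimately show "\<forall>\<^sub>F t in at 0.
        t / \<theta> (p $ i + t, p $ j) = partial i E (q t) - partial j E (q t)"
    proof eventually_elim
      case (elim t)
      then show ?case
        using partial_diff_eq[OF assms(1), of "q t"] assms(3) by (simp add: q_nth)
    qed
  qed
  ultimately show ?thesis
    by (rule tendsto_unique[OF at_neq_bot])
qed

text \<open>The factor \<open>\<theta>\<close> cancels, so \<open>edge_eta\<close> is linear on the
  orthant and its derivatives are constants.\<close>

lemma edge_eta_eq:
  assumes "p \<in> pos_orthant"
  shows "edge_eta \<theta> E i j p = (if C4_adj i j then p $ i - p $ j else 0)"
proof -
  have "\<theta> (p $ i, p $ j) > 0"
    using assms by (auto simp: pos_orthant_def intro: weight_pos)
  then show ?thesis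
    using partial_diff_eq[OF _ assms, of i j] partial_diff_eq_0[OF _ assms, of i j]
    by (cases "p $ i = p $ j") (auto simp: edge_eta_def edge_theta_def)
qed

lemma partial_edge_eta:
  assumes "p \<in> pos_orthant"
  shows "partial i (edge_eta \<theta> E i j) p = (if C4_adj i j then 1 else 0)"
    and "partial j (edge_eta \<theta> E i j) p = (if C4_adj i j then -1 else 0)"
proof -
  define G where "G q = (if C4_adj i j then q $ i - q $ j else 0)" for q :: "real^4"
  \<comment> \<open>A bounded linear map is its own derivative.\<close>
  have "(G has_derivative G) (at p)"
    unfolding G_def
    by (cases "C4_adj i j")
      (auto intro!: bounded_linear_imp_has_derivative bounded_linear_sub bounded_linear_vec_nth)
  moreover have "partial k (edge_eta \<theta> E i j) p = partial k G p" for k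
    by (rule partial_cong_on_pos_orthant[OF _ assms]) (simp add: edge_eta_eq G_def)
  ultimately have "partial k (edge_eta \<theta> E i j) p = G (axis k 1)" for k
    by (simp add: partial_eq_derivative)
  then show "partial i (edge_eta \<theta> E i j) p = (if C4_adj i j then 1 else 0)"
    and "partial j (edge_eta \<theta> E i j) p = (if C4_adj i j then -1 else 0)"
    using not_C4_adj_refl[of i] by (auto simp: G_def axis_def)
qed

end

end

section \<open>The inequality on the cycle\<close>

lemma C4_adj_simps:
  "C4_adj 1 2" "C4_adj 2 1" "C4_adj 2 3" "C4_adj 3 2" "C4_adj 3 4" "C4_adj 4 3" "C4_adj 4 1"
  "C4_adj 1 4" "\<not> C4_adj 1 3" "\<not> C4_adj 3 1" "\<not> C4_adj 2 4" "\<not> C4_adj 4 2"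
  by (simp_all add: C4_adj_def C4_edges_def)

theorem mainTheorem9:
  fixes \<theta> :: "real \<times> real \<Rightarrow> real" and E :: "real^4 \<Rightarrow> real"
  assumes "weight_function \<theta>"
    and "pos_homogeneous \<theta>"
    and "concave_on ({0..} \<times> {0..}) \<theta>"
    and "smooth_on pos_orthant E"
    and "\<And>i j p. C4_adj i j \<Longrightarrow> p \<in> pos_orthant \<Longrightarrow> p $ i \<noteq> p $ j \<Longrightarrow>
           \<theta> (p $ i, p $ j) = (p $ i - p $ j) / (partial i E p - partial j E p)"
  shows "C4_property \<theta> E"
  unfolding C4_property_def
proof (intro ballI allI)
  fix p f :: "real^4"
  assume "p \<in> interior_prob_simplex"
  then have p: "p \<in> pos_orthant"
    by (auto simp: interior_prob_simplex_def pos_orthant_def)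
  then have pos: "p $ k > 0" for k
    by (auto simp: pos_orthant_def)
  \<comment> \<open>For an edge, \<open>A i j\<close> and \<open>A j i\<close> form the gradient of
    \<open>\<theta>\<close> at \<open>(p $ i, p $ j)\<close>, by symmetry.\<close>
  define A where "A i j = partial i (edge_theta \<theta> i j) p" for i j
  define T where "T i j = \<theta> (p $ i, p $ j)" for i j
  have T_sym: "T i j = T j i" for i j
    unfolding T_def using weight_sym[OF assms(1) pos pos] .
  have T_pos: "T i j > 0" for i j
    unfolding T_def using weight_pos[OF assms(1) pos pos] .
  have derivative: "frechet_derivative \<theta> (at (p $ i, p $ j)) (x, y) = A i j * x + A j i * y"
    if "C4_adj i j" for i j x y
  proof -
    let ?D = "frechet_derivative \<theta> (at (p $ i, p $ j))"
    have "linear ?D"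
      using weight_has_derivative[OF assms(1) pos pos] by (rule has_derivative_linear)
    then have "?D (x *\<^sub>R (1, 0) + y *\<^sub>R (0, 1)) = x * ?D (1, 0) + y * ?D (0, 1)"
      by (simp only: linear_add linear_cmul real_scaleR_def)
    then show ?thesis
      using partial_edge_theta[OF assms(1) p that] partial_edge_theta_sym[OF assms(1) p, of j j i]
      by (simp add: A_def mult.commute)
  qed
  have Euler: "A i j * p $ i + A j i * p $ j = T i j" if "C4_adj i j" for i j
    using weight_Euler[OF assms(1,2) pos pos, of i j] that by (simp add: derivative T_def)
  have tangent: "T k l \<le> A i j * p $ k + A j i * p $ l" if "C4_adj i j" for i j k l
    using weight_le_derivative[OF assms(1-3) pos pos less_imp_le[OF pos] less_imp_le[OF pos],
        of k l i j] that
    by (simp add: derivative T_def)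
  define S where "S = T 1 2 + T 2 3 + T 3 4 + T 4 1"
  \<comment> \<open>For \<open>i\<close>, \<open>j\<close>, \<open>k\<close>, \<open>l\<close> in
    cyclic order, this becomes the coefficient of \<open>(f $ i - f $ j)\<^sup>2\<close> in the
    difference of the two sides.\<close>
  define c where "c i j k l = 1/2 * (A i j * p $ l + A j i * p $ k + T i j + T j k + T l i)"
    for i j k l
  have theta: "edge_theta \<theta> i j p = (if C4_adj i j then T i j else 0)" for i j
    by (simp add: edge_theta_def T_def)
  have A_nonadj: "A i j = 0" if "\<not> C4_adj i j" for i j
    using that by (simp add: A_def edge_theta_def partial_def)
  have eta: "edge_eta \<theta> E i j p = (if C4_adj i j then p $ i - p $ j else 0)"
    "partial i (edge_eta \<theta> E i j) p = (if C4_adj i j then 1 else 0)"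
    "partial j (edge_eta \<theta> E i j) p = (if C4_adj i j then -1 else 0)" for i j
    by (rule edge_eta_eq partial_edge_eta, fact+)+
  have edge: "Gamma2_edge \<theta> E i j p f =
      (f $ i - f $ j)\<^sup>2 * (2 * T i j - 1/2 * (A i j - A j i) * (p $ i - p $ j))"
    if "C4_adj i j" for i j
    using that partial_edge_theta_sym[OF assms(1) p, of j i j]
    by (simp add: Gamma2_edge_def theta eta A_def algebra_simps)
  \<comment> \<open>The coefficient of the same square in \<open>Gamma2_C4\<close>, with both
    orientations of the edge collected.\<close>
  define g where "g i j k l = 1/2 * (A i j * (p $ j + p $ l - 2 * p $ i)
      + A j i * (p $ i + p $ k - 2 * p $ j) + 6 * T i j + T j k + T l i)" for i j k l
  \<comment> \<open>Euler's identity absorbs the terms \<open>A i j * p $ i\<close> and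
    \<open>A j i * p $ j\<close> left after subtraction.\<close>
  have g_c: "g i j k l = c i j k l + (2 * T i j - 1/2 * (A i j - A j i) * (p $ i - p $ j))"
    if "C4_adj i j" for i j k l
    using Euler[OF that] by (simp add: g_def c_def field_simps)
  \<comment> \<open>On a diagonal only the last summand of \<open>Gamma2_C4\<close> survives; its
    two orientations together give \<open>- 1/2 * S\<close>.\<close>
  have "Gamma2_C4 \<theta> E p f =
      (f $ 1 - f $ 2)\<^sup>2 * g 1 2 3 4 + (f $ 2 - f $ 3)\<^sup>2 * g 2 3 4 1
      + (f $ 3 - f $ 4)\<^sup>2 * g 3 4 1 2 + (f $ 4 - f $ 1)\<^sup>2 * g 4 1 2 3
      - 1/2 * S * (f $ 1 - f $ 3)\<^sup>2 - 1/2 * S * (f $ 2 - f $ 4)\<^sup>2"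
    unfolding Gamma2_C4_def sum_4 A_def[symmetric] theta eta
    by (simp add: C4_adj_simps not_C4_adj_refl A_nonadj g_def S_def
        T_sym[of 2 1] T_sym[of 3 2] T_sym[of 4 3] T_sym[of 1 4])
      algebra
  moreover have "(\<Sum>(i, j)\<in>C4_edges. Gamma2_edge \<theta> E i j p f) = Gamma2_edge \<theta> E 1 2 p f
      + Gamma2_edge \<theta> E 2 3 p f + Gamma2_edge \<theta> E 3 4 p f + Gamma2_edge \<theta> E 4 1 p f"
    by (simp add: C4_edges_def)
  ultimately have "Gamma2_C4 \<theta> E p f - (\<Sum>(i, j)\<in>C4_edges. Gamma2_edge \<theta> E i j p f) =
      (f $ 1 - f $ 2)\<^sup>2 * c 1 2 3 4 + (f $ 2 - f $ 3)\<^sup>2 * c 2 3 4 1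
      + (f $ 3 - f $ 4)\<^sup>2 * c 3 4 1 2 + (f $ 4 - f $ 1)\<^sup>2 * c 4 1 2 3
      - 1/2 * S * (f $ 1 - f $ 3)\<^sup>2 - 1/2 * S * (f $ 2 - f $ 4)\<^sup>2"
    by (simp only: edge g_c C4_adj_simps distrib_left)
  \<comment> \<open>The tangent bound in the direction \<open>(p $ l, p $ k)\<close> supplies
    \<open>T l k\<close>, the opposite edge, which is the one term of \<open>S\<close> missing from
    \<open>c\<close>.\<close>
  moreover have c_ge: "c i j k l \<ge> 1/2 * S"
    if "S = T i j + T j k + T k l + T l i" "C4_adj i j" for i j k l
    using tangent[OF that(2), of l k] that(1) T_sym[of k l] by (simp add: c_def)
  have "c 1 2 3 4 \<ge> 1/2 * S" "c 2 3 4 1 \<ge> 1/2 * S" "c 3 4 1 2 \<ge> 1/2 * S" "c 4 1 2 3 \<ge> 1/2 * S"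
    by (rule c_ge; simp add: S_def C4_adj_simps)+
  then have "(f $ 1 - f $ 2)\<^sup>2 * (1/2 * S) + (f $ 2 - f $ 3)\<^sup>2 * (1/2 * S)
      + (f $ 3 - f $ 4)\<^sup>2 * (1/2 * S) + (f $ 4 - f $ 1)\<^sup>2 * (1/2 * S)
      \<le> (f $ 1 - f $ 2)\<^sup>2 * c 1 2 3 4 + (f $ 2 - f $ 3)\<^sup>2 * c 2 3 4 1
      + (f $ 3 - f $ 4)\<^sup>2 * c 3 4 1 2 + (f $ 4 - f $ 1)\<^sup>2 * c 4 1 2 3"
    by (intro add_mono mult_left_mono) auto
  \<comment> \<open>The squares over the four sides minus those over the two diagonals form the
    square of the alternating sum.\<close>
  moreover have "(f $ 1 - f $ 2)\<^sup>2 * (1/2 * S) + (f $ 2 - f $ 3)\<^sup>2 * (1/2 * S)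
      + (f $ 3 - f $ 4)\<^sup>2 * (1/2 * S) + (f $ 4 - f $ 1)\<^sup>2 * (1/2 * S)
      - 1/2 * S * (f $ 1 - f $ 3)\<^sup>2 - 1/2 * S * (f $ 2 - f $ 4)\<^sup>2
      = 1/2 * S * (f $ 1 - f $ 2 + f $ 3 - f $ 4)\<^sup>2"
    by algebra
  moreover have "S > 0"
    using T_pos by (simp add: S_def add_pos_pos)
  then have "1/2 * S * (f $ 1 - f $ 2 + f $ 3 - f $ 4)\<^sup>2 \<ge> 0"
    by simp
  ultimately show "Gamma2_C4 \<theta> E p f \<ge> (\<Sum>(i, j)\<in>C4_edges. Gamma2_edge \<theta> E i j p f)"
    by linarith
qed

end
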